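(* For any number $n$ of agents, any incentive graph $G$ and synergy graph $\widetilde G$, and any $\beta\ge 0$, the optimal public signal $\varphi^*$ informs the agents of the average state: $\bar x \equiv \frac1n\sum_{i=1}^n x_i \in \mathcal I(\varphi^* )$.
   Context: Model. There are one principal and $n$ agents. Agent $i$ chooses $a_i\in\mathbb R$; $\mathbf a=(a_1,\dots,a_n)'$. The state $\mathbf x=(x_1,\dots,x_n)'$ is distributed as $N(\mu\mathbf 1_n,\sigma^2 I_n)$, with $\mu\in\mathbb R$, $\sigma^2>0$, $\mathbf 1_n$ the vector of ones. The incentive graph $G=[g_{ij}]$ and the synergy graph $\widetilde G=[\tilde g_{ij}]$ are symmetric $n\times n$ matrices with entries in $\{0,1\}$ and zero diagonal; $\beta\ge0$ is a parameter. Agent $i$'s payoff is $u_i(\mathbf a,\mathbf x)=-(a_i-x_i)^2-\beta\sum_{j} g_{ij}(a_i-a_j)^2$; the principal's payoff is $v(\mathbf a,\mathbf x)=-\sum_i (a_i-x_i)^2-\beta\sum_i\sum_j\tilde g_{ij}(a_i-a_j)^2$. A public signal is a map (Markov kernel) $\varphi:\mathbb R^n\to\Delta(M)$, $M$ a measurable space. All agents observe the realization $m$ and nothing else, form $\hat{\mathbf x}=\mathbb E[\mathbf x\mid m]$, and play the unique Nash equilibrium $\mathbf a^*=B\hat{\mathbf x}$, $B=(I_n+\beta L)^{-1}$, where $L=D_G-G$ and $\widetilde L=D_{\widetilde G}-\widetilde G$ are the graph Laplacians ($D$ the diagonal degree matrix). Then $\mathbb E[v(\mathbf a^*,\mathbf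 x)]=-\mathbb E[\mathbf x'\mathbf x]+\mathbb E[\hat{\mathbf x}'V\hat{\mathbf x}]$ with $V=B'(I_n-2\beta(\widetilde L-L))B$. A signal is optimal if it maximizes $\mathbb E[v(\mathbf a^*,\mathbf x)]$ (equivalently $\mathbb E[\hat{\mathbf x}'V\hat{\mathbf x}]$) over all public signals. By a known theorem, if $\mathbf z_1,\dots,\mathbf z_n$ is an orthonormal eigenbasis of the symmetric matrix $V$ with eigenvalues $\omega_1,\dots,\omega_n$, then the signal disclosing exactly the statistics $\mathbf z_j'\mathbf x$ for all $j$ with $\omega_j\ge0$ is optimal; "the optimal public signal" $\varphi^*$ denotes this signal. A signal $\varphi$ informs the agents of a random variable $y$, written $y\in\mathcal I(\varphi)$, if $\mathbb E[y\mid m]=y$ (almost surely). *)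

theory Defs
  imports "HOL-Probability.Probability"
begin

text \<open>The agents are the elements of a finite index type \<open>'n\<close>.\<close>

definition adjacency_matrix :: "real^'n^'n \<Rightarrow> bool" where
  "adjacency_matrix G \<longleftrightarrow>
     transpose G = G \<and> (\<forall>i j. G $ i $ j \<in> {0, 1}) \<and> (\<forall>i. G $ i $ i = 0)"

definition degree_matrix :: "real^'n^'n \<Rightarrow> real^'n^'n" where
  "degree_matrix G = (\<chi> i j. if i = j then \<Sum>k\<in>UNIV. G $ i $ k else 0)"

definition laplacian :: "real^'n^'n \<Rightarrow> real^'n^'n" where
  "laplacian G = degree_matrix G - G"

text \<open>
  Agent \<open>i\<close> maximises the expectation of
  \<open>- (a\<^sub>i - x\<^sub>i)^2 - \<beta> * (\<Sum>j. g\<^sub>i\<^sub>j * (a\<^sub>i - a\<^sub>j)^2)\<close>, so that the unique Nash equilibrium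
  at the posterior mean \<open>y\<close> of the state is \<open>B y\<close> with \<open>B\<close> as follows.
\<close>

definition equilibrium_matrix :: "real \<Rightarrow> real^'n^'n \<Rightarrow> real^'n^'n" where
  "equilibrium_matrix \<beta> G = matrix_inv (mat 1 + \<beta> *\<^sub>R laplacian G)"

text \<open>
  The principal's payoff is
  \<open>- (\<Sum>i. (a\<^sub>i - x\<^sub>i)^2) - \<beta> * (\<Sum>i. \<Sum>j. h\<^sub>i\<^sub>j * (a\<^sub>i - a\<^sub>j)^2)\<close>, where \<open>H\<close> is the synergy graph.
  In equilibrium its expectation is \<open>- E (x \<bullet> x) + E (y \<bullet> V y)\<close> with \<open>V\<close> as follows, where
  \<open>y\<close> is the posterior mean.
\<close>

definition value_matrix :: "real \<Rightarrow> real^'n^'n \<Rightarrow> real^'n^'n \<Rightarrow> real^'n^'n" where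
  "value_matrix \<beta> G H =
     transpose (equilibrium_matrix \<beta> G)
       ** (mat 1 - (2 * \<beta>) *\<^sub>R (laplacian H - laplacian G))
       ** equilibrium_matrix \<beta> G"

text \<open>A family of orthonormal vectors indexed by \<open>'n\<close> is automatically a basis of \<open>real^'n\<close>.\<close>

definition orthonormal_eigenbasis ::
    "real^'n^'n \<Rightarrow> ('n \<Rightarrow> real^'n) \<Rightarrow> ('n \<Rightarrow> real) \<Rightarrow> bool" where
  "orthonormal_eigenbasis A z \<omega> \<longleftrightarrow>
     (\<forall>i j. z i \<bullet> z j = (if i = j then 1 else 0)) \<and>
     (\<forall>j. A *v z j = \<omega> j *\<^sub>R z j)"

text \<open>
  The law \<open>N(\<mu> 1, \<sigma>^2 I)\<close> of the state. As for \<^const>\<open>normal_density\<close>, the parameter \<open>\<sigma>\<close> is the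
  standard deviation.
\<close>

definition state_law :: "real \<Rightarrow> real \<Rightarrow> (real^'n) measure" where
  "state_law \<mu> \<sigma> = density lborel (\<lambda>x. ennreal (\<Prod>i\<in>UNIV. normal_density \<mu> \<sigma> (x $ i)))"

text \<open>A public signal with message space \<open>M\<close> is a Markov kernel from states to messages.\<close>

definition public_signal :: "'m measure \<Rightarrow> (real^'n \<Rightarrow> 'm measure) \<Rightarrow> bool" where
  "public_signal M \<phi> \<longleftrightarrow> \<phi> \<in> borel \<rightarrow>\<^sub>M prob_algebra M"

definition joint_law ::
    "(real^'n) measure \<Rightarrow> 'm measure \<Rightarrow> (real^'n \<Rightarrow> 'm measure) \<Rightarrow> ((real^'n) \<times> 'm) measure" where
  "joint_law P M \<phi> = bind P (\<lambda>x. distr (\<phi> x) (borel \<Otimes>\<^sub>M M) (\<lambda>m. (x, m)))"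

definition message_algebra ::
    "(real^'n) measure \<Rightarrow> 'm measure \<Rightarrow> (real^'n \<Rightarrow> 'm measure) \<Rightarrow> ((real^'n) \<times> 'm) measure" where
  "message_algebra P M \<phi> = vimage_algebra (space (joint_law P M \<phi>)) snd M"

text \<open>
  The set of all random variables \<open>y\<close> (functions of the state) with \<open>E[y | m] = y\<close> almost surely.
  Integrability is required because \<^const>\<open>real_cond_exp\<close> is a total function that carries no
  meaning for non-integrable arguments.
\<close>

definition informs ::
    "(real^'n) measure \<Rightarrow> 'm measure \<Rightarrow> (real^'n \<Rightarrow> 'm measure) \<Rightarrow> (real^'n \<Rightarrow> real) set" where
  "informs P M \<phi> =
     {y. integrable P y \<and>
         (AE w in joint_law P M \<phi>.
            real_cond_exp (joint_law P M \<phi>) (message_algebra P M \<phi>) (\<lambda>(x, m). y x) w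
              = y (fst w))}"

text \<open>
  The optimal public signal discloses exactly the statistics \<open>z j \<bullet> x\<close> with \<open>\<omega> j \<ge> 0\<close>: its
  message is, with probability one, the family of their values.
\<close>

definition optimal_messages :: "('n \<Rightarrow> real) \<Rightarrow> ('n \<Rightarrow> real) measure" where
  "optimal_messages \<omega> = (\<Pi>\<^sub>M j\<in>{j. 0 \<le> \<omega> j}. borel)"

definition optimal_signal ::
    "('n \<Rightarrow> real^'n) \<Rightarrow> ('n \<Rightarrow> real) \<Rightarrow> real^'n \<Rightarrow> ('n \<Rightarrow> real) measure" where
  "optimal_signal z \<omega> = (\<lambda>x. return (optimal_messages \<omega>) (\<lambda>j\<in>{j. 0 \<le> \<omega> j}. z j \<bullet> x))"

lemma public_signal_optimal_signal: "public_signal (optimal_messages \<omega>) (optimal_signal z \<omega>)"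
proof -
  have "(\<lambda>x. \<lambda>j\<in>{j. 0 \<le> \<omega> j}. z j \<bullet> x) \<in> borel \<rightarrow>\<^sub>M optimal_messages \<omega>"
    unfolding optimal_messages_def by (rule measurable_restrict) simp
  moreover have "return (optimal_messages \<omega>) \<in> optimal_messages \<omega> \<rightarrow>\<^sub>M prob_algebra (optimal_messages \<omega>)"
    by (rule measurable_return_prob_space)
  ultimately show ?thesis
    unfolding public_signal_def optimal_signal_def by (rule measurable_compose)
qed

definition average_state :: "real^'n \<Rightarrow> real" where
  "average_state x = (1 / real CARD('n)) * (\<Sum>i\<in>UNIV. x $ i)"

end

theory Submission
  imports Defs
begin

text \<open>
  All rows and columns of a Laplacian sum to zero. Hence the vector \<open>\<one>\<close> of ones is fixed by the
  equilibrium matrix and its transpose, and so it is an eigenvector of the value matrix \<open>V\<close> for the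
  eigenvalue \<open>1\<close>. As \<open>\<one>\<close> is also a left eigenvector, it is orthogonal to every eigenvector of \<open>V\<close>
  with a negative eigenvalue. Expanding \<open>\<one>\<close> in the eigenbasis writes the average state as a linear
  combination of the disclosed statistics.
\<close>

section \<open>The vector of ones and the value matrix\<close>

text \<open>In difference form it is visible that constant vectors lie in the kernel, and the
  quadratic form can be symmetrised into squares.\<close>

lemma laplacian_component:
  "(laplacian G *v x) $ i = (\<Sum>j\<in>UNIV. G $ i $ j * (x $ i - x $ j))"
proof -
  have "(laplacian G *v x) $ i
      = (\<Sum>j\<in>UNIV. (if i = j then \<Sum>k\<in>UNIV. G $ i $ k else 0) * x $ j)
        - (\<Sum>j\<in>UNIV. G $ i $ j * x $ j)"
    by (simp add: laplacian_def degree_matrix_def matrix_vector_mult_def left_diff_distrib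
        sum_subtractf)
  also have "(\<Sum>j\<in>UNIV. (if i = j then \<Sum>k\<in>UNIV. G $ i $ k else 0) * x $ j)
      = (\<Sum>k\<in>UNIV. G $ i $ k) * x $ i"
    by (subst sum.cong[OF refl, where h = "\<lambda>j. if i = j then (\<Sum>k\<in>UNIV. G $ i $ k) * x $ j else 0"])
       auto
  finally show ?thesis
    by (simp add: right_diff_distrib sum_subtractf sum_distrib_right)
qed

lemma laplacian_mult_one: "laplacian G *v 1 = 0"
  by (simp add: vec_eq_iff laplacian_component)

lemma transpose_laplacian:
  assumes "transpose G = G"
  shows "transpose (laplacian G) = laplacian G"
proof -
  have "G $ j $ i = G $ i $ j" for i j
    using assms by (metis transpose_def vec_lambda_beta)
  then show ?thesis
    by (auto simp: laplacian_def degree_matrix_def transpose_def vec_eq_iff)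
qed

lemma one_mult_laplacian:
  assumes "transpose G = G"
  shows "1 v* laplacian G = 0"
  by (metis assms laplacian_mult_one transpose_laplacian transpose_matrix_vector)

text \<open>Swapping the roles of \<open>i\<close> and \<open>j\<close> and averaging the two
  versions of the quadratic form gives half of the sum of all
  \<open>G $ i $ j * (x $ i - x $ j)\<^sup>2\<close>.\<close>

lemma laplacian_nonneg:
  fixes G :: "real^'n^'n"
  assumes sym: "transpose G = G" and nonneg: "\<And>i j. 0 \<le> G $ i $ j"
  shows "0 \<le> x \<bullet> (laplacian G *v x)"
proof -
  have G: "G $ j $ i = G $ i $ j" for i j
    using sym by (metis transpose_def vec_lambda_beta)
  have q: "x \<bullet> (laplacian G *v x) = (\<Sum>i\<in>UNIV. \<Sum>j\<in>UNIV. G $ i $ j * x $ i * (x $ i - x $ j))"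
    by (simp add: inner_vec_def laplacian_component sum_distrib_left mult_ac)
  also have "\<dots> = (\<Sum>i\<in>UNIV. \<Sum>j\<in>UNIV. G $ i $ j * x $ j * (x $ j - x $ i))"
    by (subst sum.swap) (simp add: G)
  finally have "2 * (x \<bullet> (laplacian G *v x))
      = (\<Sum>i\<in>UNIV. \<Sum>j\<in>UNIV. G $ i $ j * (x $ i - x $ j)\<^sup>2)"
    \<comment> \<open>One copy is expanded by \<open>q\<close>, the other by the swapped
      sum.\<close>
    unfolding mult_2 by (subst (1) q)
       (simp add: sum.distrib[symmetric] power2_eq_square algebra_simps)
  moreover have "\<dots> \<ge> 0"
    by (intro sum_nonneg mult_nonneg_nonneg nonneg zero_le_power2)
  ultimately show ?thesis
    by simp
qed

text \<open>The matrix is positive definite: its quadratic form is at least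
  \<open>x \<bullet> x\<close>, so its kernel is trivial. This makes
  \<open>equilibrium_matrix\<close> a genuine inverse.\<close>

lemma invertible_mat_plus_laplacian:
  assumes "adjacency_matrix G" "\<beta> \<ge> 0"
  shows "invertible (mat 1 + \<beta> *\<^sub>R laplacian G)"
proof -
  have "x = 0" if "(mat 1 + \<beta> *\<^sub>R laplacian G) *v x = 0" for x
  proof -
    have "0 = x \<bullet> ((mat 1 + \<beta> *\<^sub>R laplacian G) *v x)"
      using that by simp
    also have "\<dots> = x \<bullet> x + \<beta> * (x \<bullet> (laplacian G *v x))"
      by (simp add: matrix_vector_mult_add_rdistrib inner_add_right
          flip: scaleR_matrix_vector_assoc)
    also have "\<dots> \<ge> x \<bullet> x"
    proof -
      have "0 \<le> G $ i $ j" for i j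
        using assms(1) unfolding adjacency_matrix_def
        by (metis empty_iff insert_iff order_refl zero_le_one)
      then show ?thesis
        using assms by (simp add: laplacian_nonneg adjacency_matrix_def)
    qed
    finally show "x = 0"
      by (metis inner_ge_zero inner_eq_zero_iff order_antisym)
  qed
  then show ?thesis
    by (metis invertible_left_inverse matrix_left_invertible_ker)
qed

lemma equilibrium_matrix_one:
  assumes "adjacency_matrix G" "\<beta> \<ge> 0"
  shows "equilibrium_matrix \<beta> G *v 1 = 1" "1 v* equilibrium_matrix \<beta> G = 1"
proof -
  let ?A = "mat 1 + \<beta> *\<^sub>R laplacian G"
  have sym: "transpose G = G"
    using assms(1) by (simp add: adjacency_matrix_def)
  have inv: "?A ** equilibrium_matrix \<beta> G = mat 1" "equilibrium_matrix \<beta> G ** ?A = mat 1"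
    \<comment> \<open>\<open>matrix_inv\<close> is a choice among two-sided inverses; invertibility
      ensures that the chosen matrix is one.\<close>
    using someI_ex[OF invertible_mat_plus_laplacian[OF assms, unfolded invertible_def]]
    by (auto simp: equilibrium_matrix_def matrix_inv_def)
  have A: "?A *v 1 = 1"
    by (simp add: matrix_vector_mult_add_rdistrib laplacian_mult_one
        flip: scaleR_matrix_vector_assoc)
  have "transpose ?A = ?A"
    using transpose_laplacian[OF sym]
    by (auto simp: transpose_def vec_eq_iff mat_def)
  then have A': "1 v* ?A = 1"
    by (metis A transpose_matrix_vector)
  show "equilibrium_matrix \<beta> G *v 1 = 1"
    by (metis A inv(2) matrix_vector_mul_assoc matrix_vector_mul_lid)
  show "1 v* equilibrium_matrix \<beta> G = 1"
    by (metis A' inv(1) vector_matrix_mul_assoc vector_matrix_mul_rid)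
qed

text \<open>The row vector passes unchanged through the three factors in turn. The transposed factor
  acts on it as \<open>equilibrium_matrix \<beta> G\<close> acts on the column \<open>1\<close>; the
  middle factor is symmetric and its Laplacians annihilate \<open>1\<close>.\<close>

lemma one_mult_value_matrix:
  assumes "adjacency_matrix G" "adjacency_matrix H" "\<beta> \<ge> 0"
  shows "1 v* value_matrix \<beta> G H = 1"
proof -
  let ?S = "mat 1 - (2 * \<beta>) *\<^sub>R (laplacian H - laplacian G)"
  have sym: "transpose G = G" "transpose H = H"
    using assms(1,2) by (simp_all add: adjacency_matrix_def)
  have "transpose ?S = ?S"
    using transpose_laplacian[OF sym(1)] transpose_laplacian[OF sym(2)]
    by (auto simp: transpose_def vec_eq_iff mat_def)
  moreover have "?S *v 1 = 1"
    by (simp add: matrix_vector_mult_diff_rdistrib laplacian_mult_one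
        flip: scaleR_matrix_vector_assoc)
  ultimately have "1 v* ?S = 1"
    by (metis transpose_matrix_vector)
  moreover have "1 v* transpose (equilibrium_matrix \<beta> G) = 1"
    using equilibrium_matrix_one(1)[OF assms(1,3)] by simp
  ultimately show ?thesis
    unfolding value_matrix_def
    using equilibrium_matrix_one(2)[OF assms(1,3)] by (metis vector_matrix_mul_assoc)
qed

text \<open>Parseval's identity. The rows \<open>z j\<close> form a square matrix with
  \<open>?Z ** transpose ?Z = mat 1\<close>; a one-sided inverse of a square matrix is two-sided,
  which replaces an argument that the family spans.\<close>

lemma inner_orthonormal_expand:
  fixes z :: "'n \<Rightarrow> real^'n"
  assumes "\<And>i j. z i \<bullet> z j = (if i = j then 1 else 0)"
  shows "x \<bullet> y = (\<Sum>j\<in>UNIV. (z j \<bullet> x) * (z j \<bullet> y))"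
proof -
  let ?Z = "\<chi> j. z j"
  have row: "(?Z *v w) $ j = z j \<bullet> w" for w j
    by (simp add: matrix_vector_mult_def inner_vec_def)
  have "?Z ** transpose ?Z = mat 1"
    using assms by (simp add: vec_eq_iff matrix_matrix_mult_def transpose_def mat_def inner_vec_def)
  then have "transpose ?Z ** ?Z = mat 1"
    by (simp add: matrix_left_right_inverse)
  then have "x \<bullet> y = x \<bullet> (transpose ?Z *v (?Z *v y))"
    by (simp add: matrix_vector_mul_assoc)
  also have "\<dots> = (?Z *v x) \<bullet> (?Z *v y)"
    by (metis dot_lmul_matrix transpose_matrix_vector transpose_transpose)
  finally show ?thesis
    by (simp add: inner_vec_def[of "?Z *v x"] row)
qed

lemma average_state_eq_disclosed:
  fixes z :: "'n \<Rightarrow> real^'n"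
  assumes "adjacency_matrix G" "adjacency_matrix H" "\<beta> \<ge> 0"
    and basis: "orthonormal_eigenbasis (value_matrix \<beta> G H) z \<omega>"
  shows "average_state x
    = (1 / real CARD('n)) * (\<Sum>j\<in>{j. 0 \<le> \<omega> j}. (z j \<bullet> 1) * (z j \<bullet> x))"
proof -
  have zero: "z j \<bullet> 1 = 0" if "\<not> 0 \<le> \<omega> j" for j
  proof -
    \<comment> \<open>Moving the value matrix across the inner product gives
      \<open>z j \<bullet> 1 = \<omega> j * (z j \<bullet> 1)\<close>, and
      \<open>1 - \<omega> j\<close> is positive for negative \<open>\<omega> j\<close>.\<close>
    have "z j \<bullet> 1 = (1 v* value_matrix \<beta> G H) \<bullet> z j"
      by (simp add: one_mult_value_matrix assms inner_commute)
    also have "\<dots> = 1 \<bullet> (\<omega> j *\<^sub>R z j)"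
      using basis by (simp add: dot_lmul_matrix orthonormal_eigenbasis_def)
    finally have "(1 - \<omega> j) * (z j \<bullet> 1) = 0"
      by (simp add: inner_commute algebra_simps)
    then show ?thesis
      using that by simp
  qed
  have "1 \<bullet> x = (\<Sum>j\<in>UNIV. (z j \<bullet> 1) * (z j \<bullet> x))"
    using basis by (intro inner_orthonormal_expand) (simp add: orthonormal_eigenbasis_def)
  also have "\<dots> = (\<Sum>j\<in>{j. 0 \<le> \<omega> j}. (z j \<bullet> 1) * (z j \<bullet> x))"
    using zero by (intro sum.mono_neutral_right) auto
  finally show ?thesis
    by (simp add: average_state_def inner_vec_def)
qed

section \<open>The Gaussian law of the state\<close>

text \<open>Tonelli's theorem for a product over \<open>Basis\<close>, transported to coordinates:
  the basis vectors of \<open>real^'n\<close> are the unit vectors \<open>axis i 1\<close>.\<close>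

lemma nn_integral_lborel_prod_vec:
  fixes f :: "'n::finite \<Rightarrow> real \<Rightarrow> ennreal"
  assumes [measurable]: "\<And>i. f i \<in> borel_measurable borel"
  shows "(\<integral>\<^sup>+ (x :: real^'n). (\<Prod>i\<in>UNIV. f i (x $ i)) \<partial>lborel) = (\<Prod>i\<in>UNIV. \<integral>\<^sup>+ t. f i t \<partial>lborel)"
proof -
  define e where "e i = (axis i 1 :: real^'n)" for i
  have e: "inj e"
    by (auto simp: e_def inj_on_def axis_eq_axis)
  have basis: "Basis = range e"
    by (auto simp: Basis_vec_def e_def)
  have prod: "(\<Prod>b\<in>Basis. F b) = (\<Prod>i\<in>UNIV. F (e i))" for F :: "_ \<Rightarrow> ennreal"
    unfolding basis by (simp add: prod.reindex[OF e])
  have comp: "x \<bullet> e i = x $ i" for x i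
    by (simp add: e_def cart_eq_inner_axis)
  show ?thesis
    \<comment> \<open>The factors are indexed by basis vectors here, so \<open>inv e\<close>
      recovers the coordinate.\<close>
    using nn_integral_lborel_prod[of "\<lambda>b. f (inv e b)"]
    by (simp add: prod comp inv_f_f[OF e])
qed

lemma nn_integral_normal_density:
  assumes "\<sigma> > 0"
  shows "(\<integral>\<^sup>+ t. ennreal (normal_density \<mu> \<sigma> t) \<partial>lborel) = 1"
  by (simp add: assms nn_integral_eq_integral normal_density_nonneg)

lemma prob_space_state_law:
  assumes "\<sigma> > 0"
  shows "prob_space (state_law \<mu> \<sigma> :: (real^'n) measure)"
proof
  show "emeasure (state_law \<mu> \<sigma>) (space (state_law \<mu> \<sigma> :: (real^'n) measure)) = 1"
    using assms nn_integral_lborel_prod_vec[of "\<lambda>i :: 'n. \<lambda>t. ennreal (normal_density \<mu> \<sigma> t)"]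
    by (simp add: state_law_def emeasure_density nn_integral_normal_density normal_density_nonneg
        flip: prod_ennreal)
qed

lemma sets_state_law [measurable_cong]: "sets (state_law \<mu> \<sigma>) = sets borel"
  by (simp add: state_law_def)

lemma integrable_state_law_component:
  assumes "\<sigma> > 0"
  shows "integrable (state_law \<mu> \<sigma>) (\<lambda>x :: real^'n. x $ k)"
proof (rule integrableI_bounded)
  \<comment> \<open>Absorbing the absolute value into the \<open>k\<close>-th density keeps the
    integrand a product. Its integral is then one first absolute moment times total masses equal to
    1.\<close>
  let ?f = "\<lambda>i t. ennreal (if i = k then normal_density \<mu> \<sigma> t * \<bar>t\<bar> else normal_density \<mu> \<sigma> t)"
  show "(\<lambda>x :: real^'n. x $ k) \<in> borel_measurable (state_law \<mu> \<sigma>)"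
    by measurable
  have "(\<integral>\<^sup>+ x. ennreal (norm (x $ k)) \<partial>(state_law \<mu> \<sigma> :: (real^'n) measure))
      = (\<integral>\<^sup>+ (x :: real^'n). (\<Prod>i\<in>UNIV. ?f i (x $ i)) \<partial>lborel)"
    unfolding state_law_def
  proof (subst nn_integral_density; (intro nn_integral_cong)?)
    fix x :: "real^'n"
    have "(\<Prod>i\<in>UNIV. ?f i (x $ i))
        = ennreal (\<Prod>i\<in>UNIV. normal_density \<mu> \<sigma> (x $ i) * (if i = k then \<bar>x $ i\<bar> else 1))"
      by (subst prod_ennreal[symmetric])
         (auto intro!: prod.cong simp: normal_density_nonneg)
    also have "\<dots> = ennreal ((\<Prod>i\<in>UNIV. normal_density \<mu> \<sigma> (x $ i)) * \<bar>x $ k\<bar>)"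
      by (simp add: prod.distrib)
    finally show "ennreal (\<Prod>i\<in>UNIV. normal_density \<mu> \<sigma> (x $ i)) * ennreal (norm (x $ k))
        = (\<Prod>i\<in>UNIV. ?f i (x $ i))"
      by (simp add: ennreal_mult'')
  qed auto
  also have "\<dots> = (\<Prod>i\<in>UNIV. \<integral>\<^sup>+ t. ?f i t \<partial>lborel)"
    by (rule nn_integral_lborel_prod_vec) simp
  also have "\<dots> < \<infinity>"
  proof -
    have "integrable lborel (\<lambda>t. normal_density \<mu> \<sigma> t * \<bar>t\<bar>)"
      using integrable_abs[OF integrable_normal_moment_nz_1[OF assms, of \<mu>]]
      by (simp add: abs_mult normal_density_nonneg)
    then have "(\<integral>\<^sup>+ t. ennreal (normal_density \<mu> \<sigma> t * \<bar>t\<bar>) \<partial>lborel) < \<infinity>"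
      by (simp add: nn_integral_eq_integral normal_density_nonneg)
    then have "(\<integral>\<^sup>+ t. ?f i t \<partial>lborel) < \<infinity>" for i
      by (cases "i = k") (simp_all add: nn_integral_normal_density assms)
    then show ?thesis
      by (auto simp: less_top[symmetric] ennreal_prod_eq_top)
  qed
  finally show "(\<integral>\<^sup>+ x. ennreal (norm (x $ k)) \<partial>(state_law \<mu> \<sigma> :: (real^'n) measure)) < \<infinity>" .
qed

section \<open>Deterministic signals\<close>

text \<open>For a deterministic signal the bind collapses to a pushforward, so the joint law is
  concentrated on the graph of \<open>f\<close>.\<close>

lemma joint_law_return:
  assumes P: "space P \<noteq> {}" "sets P = sets borel" and f: "f \<in> borel \<rightarrow>\<^sub>M M"
  shows "joint_law P M (\<lambda>x. return M (f x)) = distr P (borel \<Otimes>\<^sub>M M) (\<lambda>x. (x, f x))"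
proof -
  have [measurable]: "f \<in> P \<rightarrow>\<^sub>M M"
    using f P(2) by (simp cong: measurable_cong_sets)
  have "distr (return M (f x)) (borel \<Otimes>\<^sub>M M) (\<lambda>m. (x, m)) = return (borel \<Otimes>\<^sub>M M) (x, f x)" for x
    using f by (intro distr_return) (auto simp: measurable_space)
  moreover have "(\<lambda>x. (x, f x)) \<in> P \<rightarrow>\<^sub>M borel \<Otimes>\<^sub>M M"
    using P(2) by (auto intro!: measurable_Pair measurable_ident_sets)
  ultimately show ?thesis
    using P(1) by (simp add: joint_law_def bind_return_distr')
qed

text \<open>A function of the message is measurable for the message algebra, hence equals its own
  conditional expectation; almost surely, \<open>y\<close> is such a function.\<close>

lemma informs_return:
  assumes P: "prob_space P" "sets P = sets borel"
    and f[measurable]: "f \<in> borel \<rightarrow>\<^sub>M M" and h[measurable]: "h \<in> borel_measurable M"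
    and y: "integrable P y" "\<And>x. y x = h (f x)"
  shows "y \<in> informs P M (\<lambda>x. return M (f x))"
proof -
  interpret P: prob_space P by fact
  let ?J = "joint_law P M (\<lambda>x. return M (f x))"
  let ?F = "message_algebra P M (\<lambda>x. return M (f x))"
  have J: "?J = distr P (borel \<Otimes>\<^sub>M M) (\<lambda>x. (x, f x))"
    using P f by (intro joint_law_return P.not_empty) auto
  have [measurable]: "f \<in> P \<rightarrow>\<^sub>M M"
    using f P(2) by (simp cong: measurable_cong_sets)
  have g[measurable]: "(\<lambda>x. (x, f x)) \<in> P \<rightarrow>\<^sub>M borel \<Otimes>\<^sub>M M"
    using P(2) by (auto intro!: measurable_Pair measurable_ident_sets)
  have "y \<in> borel_measurable P"
    using y(1) by simp
  then have [measurable]: "y \<in> borel_measurable borel"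
    using P(2) by (simp cong: measurable_cong_sets)
  interpret J: prob_space ?J
    unfolding J by (rule P.prob_space_distr) (rule g)
  have sets_J [measurable_cong]: "sets ?J = sets (borel \<Otimes>\<^sub>M M)"
    by (simp add: J)
  have snd_J: "snd \<in> ?J \<rightarrow>\<^sub>M M"
    by measurable
  have "subalgebra ?J ?F"
    unfolding subalgebra_def message_algebra_def
    using measurable_sets[OF snd_J]
    by (auto simp: sets_vimage_algebra2 measurable_space[OF snd_J])
  \<comment> \<open>Finiteness of the joint law gives \<open>real_cond_exp\<close> its proper
    meaning on the message algebra.\<close>
  then interpret finite_measure_subalgebra ?J ?F
    by unfold_locales
  have "snd \<in> ?F \<rightarrow>\<^sub>M M"
    unfolding message_algebra_def
    by (rule measurable_vimage_algebra1) (auto simp: measurable_space[OF snd_J])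
  then have F: "(\<lambda>w. h (snd w)) \<in> borel_measurable ?F"
    by measurable
  have int: "integrable ?J (\<lambda>w. h (snd w))"
    unfolding J using y(1) by (simp add: integrable_distr_eq flip: y(2))
  \<comment> \<open>For arbitrary pairs this may fail; it holds on the graph of \<open>f\<close>,
    which carries all the mass.\<close>
  have "AE w in ?J. y (fst w) = h (snd w)"
    unfolding J by (subst AE_distr_iff) (auto simp: y(2))
  moreover from this
  have "AE w in ?J. real_cond_exp ?J ?F (\<lambda>(x, m). y x) w = real_cond_exp ?J ?F (\<lambda>w. h (snd w)) w"
    by (intro real_cond_exp_cong) (auto simp: case_prod_unfold)
  moreover have "AE w in ?J. real_cond_exp ?J ?F (\<lambda>w. h (snd w)) w = h (snd w)"
    by (rule real_cond_exp_F_meas[OF int F])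
  ultimately have "AE w in ?J. real_cond_exp ?J ?F (\<lambda>(x, m). y x) w = y (fst w)"
    by eventually_elim simp
  with y(1) show ?thesis
    by (simp add: informs_def)
qed

theorem proposition1:
  fixes G H :: "real^'n^'n"
    and \<beta> \<mu> \<sigma> :: real
    and z :: "'n \<Rightarrow> real^'n"
    and \<omega> :: "'n \<Rightarrow> real"
  assumes "adjacency_matrix G"
    and "adjacency_matrix H"
    and "\<beta> \<ge> 0"
    and "\<sigma> > 0"
    and "orthonormal_eigenbasis (value_matrix \<beta> G H) z \<omega>"
  shows "average_state \<in> informs (state_law \<mu> \<sigma>) (optimal_messages \<omega>) (optimal_signal z \<omega>)"
proof -
  \<comment> \<open>The decoding map: the eigenbasis expansion of the average state, with the
    statistics read off the message.\<close>
  let ?h = "\<lambda>m. (1 / real CARD('n)) * (\<Sum>j\<in>{j. 0 \<le> \<omega> j}. (z j \<bullet> 1) * m j)"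
  show ?thesis
    unfolding optimal_signal_def
  proof (rule informs_return[where h = ?h])
    show "prob_space (state_law \<mu> \<sigma>)"
      using assms(4) by (rule prob_space_state_law)
    show "sets (state_law \<mu> \<sigma>) = sets borel"
      by (rule sets_state_law)
    show "(\<lambda>x. \<lambda>j\<in>{j. 0 \<le> \<omega> j}. z j \<bullet> x) \<in> borel \<rightarrow>\<^sub>M optimal_messages \<omega>"
      unfolding optimal_messages_def by (rule measurable_restrict) simp
    show "?h \<in> borel_measurable (optimal_messages \<omega>)"
      unfolding optimal_messages_def
      by (intro borel_measurable_times borel_measurable_sum borel_measurable_const
          measurable_component_singleton)
    show "integrable (state_law \<mu> \<sigma>) average_state"
      unfolding average_state_def[abs_def]
      by (intro integrable_mult_right Bochner_Integration.integrable_sum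
          integrable_state_law_component assms(4))
    \<comment> \<open>The sum runs only over disclosed indices, so the \<open>undefined\<close>
      values of the restricted function never enter.\<close>
    show "average_state x = ?h (\<lambda>j\<in>{j. 0 \<le> \<omega> j}. z j \<bullet> x)" for x
      by (subst average_state_eq_disclosed[OF assms(1-3,5)]) simp
  qed
qed

end
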